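(* For all integers $m\ge 2$ and $i\ge 2$, $$L(m,Z_i)<m\uparrow\uparrow(2i-1),$$ where $L(m,Z_i)$ is the Ramsey length of the Zimin pattern $Z_i$ over an $m$-letter alphabet.
   Context: A word $w$ over an alphabet $\mathcal A$ encounters a pattern $p$ (a word over an alphabet $\mathcal V$ of variables) if there is a nonerasing morphism $h:\mathcal V^*\to\mathcal A^*$ (i.e. $h(v)$ is nonempty for every $v\in\mathcal V$) such that $h(p)$ is a factor (contiguous block) of $w$; otherwise $w$ avoids $p$. A pattern $p$ is $m$-unavoidable if there are not arbitrarily long words over an $m$-letter alphabet that avoid $p$. The Ramsey length $L(m,p)$ of an $m$-unavoidable pattern $p$ is the least $n$ such that every word of length $n$ over an $m$-letter alphabet encounters $p$. The Zimin patterns are defined by $Z_1=a_1$ and $Z_i=Z_{i-1}a_iZ_{i-1}$ for $i\ge2$, where $a_1,a_2,\ldots$ are distinct variables; they are $m$-unavoidable for every $m\ge 1$. Knuth's double up-arrow is defined by $x\uparrow\uparrow 0=1$ and $x\uparrow\uparrow (n+1)=x^{x\uparrow\uparrow n}$ for $n\ge 0$. *)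

theory Defs
  imports Main "HOL-Library.Sublist"
begin

text \<open>
  The morphism from words over the variables to words over \<open>A\<close> that is determined by its
  values \<open>h v\<close> on the variables maps the pattern \<open>p\<close> to \<open>concat (map h p)\<close>; a factor of a word
  is a contiguous \<open>sublist\<close> of it.
\<close>

definition encounters :: "'a set \<Rightarrow> 'a list \<Rightarrow> 'v list \<Rightarrow> bool" where
  "encounters A w p \<longleftrightarrow>
     (\<exists>h :: 'v \<Rightarrow> 'a list. (\<forall>v. h v \<noteq> [] \<and> h v \<in> lists A) \<and> sublist (concat (map h p)) w)"

text \<open>
  Letters are natural numbers, which is no restriction for finite alphabets. The value is
  meaningful only for \<open>m\<close>-unavoidable patterns \<open>p\<close>: otherwise no such \<open>n\<close> exists and
  \<open>LEAST\<close> is unspecified.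
\<close>

definition ramsey_length :: "nat \<Rightarrow> 'v list \<Rightarrow> nat" where
  "ramsey_length m p =
     (LEAST n. \<forall>A :: nat set. finite A \<and> card A = m \<longrightarrow>
        (\<forall>w \<in> lists A. length w = n \<longrightarrow> encounters A w p))"

text \<open>The variable \<open>a\<^sub>i\<close> is the number \<open>i\<close>; starting at \<open>Z\<^sub>0 = []\<close> gives \<open>Z\<^sub>1 = [1]\<close>.\<close>

fun zimin :: "nat \<Rightarrow> nat list" where
  "zimin 0 = []"
| "zimin (Suc i) = zimin i @ [Suc i] @ zimin i"

fun up_up :: "nat \<Rightarrow> nat \<Rightarrow> nat"  (infixr "\<up>\<up>" 85) where
  "x \<up>\<up> 0 = 1"
| "x \<up>\<up> (Suc n) = x ^ (x \<up>\<up> n)"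

end

theory Submission
  imports Defs
begin

text \<open>
  Suppose every word of length \<open>n\<close> over \<open>A\<close> encounters \<open>Z\<^sub>i\<close>. A word of length
  \<open>|A|\<^sup>n (n + 1) + n\<close> contains \<open>|A|\<^sup>n + 1\<close> blocks of length \<open>n\<close> separated by single
  letters, so two of these blocks coincide; the image of \<open>Z\<^sub>i\<close> inside the repeated block then
  occurs twice with a nonempty gap, and mapping \<open>a\<^sub>i\<^sub>+\<^sub>1\<close> to this gap yields an image of
  \<open>Z\<^sub>i\<^sub>+\<^sub>1\<close>. Iterating this recursion from \<open>Z\<^sub>0\<close> costs at most two exponentials
  per step.
\<close>

definition forces :: "'a set \<Rightarrow> nat \<Rightarrow> 'v list \<Rightarrow> bool" where
  "forces A n p \<longleftrightarrow> (\<forall>w \<in> lists A. length w = n \<longrightarrow> encounters A w p)"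

lemma encountersI:
  assumes "\<And>v. h v \<noteq> []" and "\<And>v. h v \<in> lists A" and "sublist (concat (map h p)) w"
  shows "encounters A w p"
  using assms unfolding encounters_def by blast

text \<open>This makes \<open>Suc i\<close> fresh for \<open>zimin i\<close>, so a morphism may be
  redefined there without changing the image of \<open>zimin i\<close>.\<close>

lemma set_zimin: "set (zimin i) \<subseteq> {..i}"
  by (induction i) auto

lemma encounters_zimin_Suc:
  assumes u: "encounters A u (zimin i)" and A: "u \<in> lists A" "c \<in> lists A" and c: "c \<noteq> []"
  shows "encounters A (u @ c @ u) (zimin (Suc i))"
proof -
  obtain h where h: "\<And>v. h v \<noteq> []" "\<And>v. h v \<in> lists A"
    and "sublist (concat (map h (zimin i))) u"
    using u unfolding encounters_def by blast
  then obtain x y where xy: "u = x @ concat (map h (zimin i)) @ y"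
    by (auto simp: sublist_def)
  \<comment> \<open>Between the two images of \<open>zimin i\<close> in \<open>u @ c @ u\<close> lie
    the rest \<open>y\<close> of the first \<open>u\<close>, then \<open>c\<close>, then the start
    \<open>x\<close> of the second \<open>u\<close>.\<close>
  define g where "g = h(Suc i := y @ c @ x)"
  have "map g (zimin i) = map h (zimin i)"
    using set_zimin[of i] by (auto simp: g_def)
  moreover have "g (Suc i) = y @ c @ x"
    by (simp add: g_def)
  ultimately have "u @ c @ u = x @ concat (map g (zimin (Suc i))) @ y"
    by (simp add: xy del: map_eq_conv cong: map_cong)
  then have "sublist (concat (map g (zimin (Suc i)))) (u @ c @ u)"
    by (auto simp: sublist_def)
  moreover have "g v \<noteq> []" "g v \<in> lists A" for v
    using h A c xy by (auto simp: g_def)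
  ultimately show ?thesis
    by (intro encountersI[of g])
qed

lemma encounters_sublist:
  assumes "encounters A u p" and "sublist u w"
  shows "encounters A w p"
  using assms unfolding encounters_def by (meson sublist_order.order_trans)

lemma repeated_block:
  assumes A: "finite A" and w: "w \<in> lists A" "card A ^ n * (n + 1) + n \<le> length w"
  obtains u c where "length u = n" "c \<noteq> []" "sublist (u @ c @ u) w"
proof -
  \<comment> \<open>The stride \<open>n + 1\<close> leaves one spare letter after each block, so
    even neighbouring blocks have a nonempty gap.\<close>
  define B where "B j = take n (drop (j * (n + 1)) w)" for j
  let ?L = "{xs. set xs \<subseteq> A \<and> length xs = n}"
  have block_end: "j * (n + 1) + n \<le> length w" if "j \<le> card A ^ n" for j
    using mult_le_mono1[OF that, of "n + 1"] w(2) by linarith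
  have len: "length (B j) = n" if "j \<le> card A ^ n" for j
    using block_end[OF that] by (simp add: B_def)
  have "B ` {..card A ^ n} \<subseteq> ?L"
    using len w(1) by (auto simp: B_def dest!: in_set_takeD in_set_dropD)
  then have "card (B ` {..card A ^ n}) \<le> card A ^ n"
    using card_mono[OF finite_lists_length_eq[OF A]] card_lists_length_eq[OF A] by metis
  then have "\<not> inj_on B {..card A ^ n}"
    by (intro pigeonhole) simp
  then obtain j k where jk: "j < k" "k \<le> card A ^ n" "B j = B k"
    unfolding inj_on_def by (metis atMost_iff linorder_neqE_nat)
  \<comment> \<open>The length of the gap from the end of block \<open>j\<close> to the start of
    block \<open>k\<close>.\<close>
  define d where "d = k * (n + 1) - (j * (n + 1) + n)"
  have "Suc j * (n + 1) \<le> k * (n + 1)"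
    using jk(1) by (intro mult_le_mono1) simp
  then have k_eq: "k * (n + 1) = d + (n + j * (n + 1))" and "d > 0"
    by (simp_all add: d_def)
  define r where "r = drop (n + j * (n + 1)) w"
  have "w = take (j * (n + 1)) w @ B j @ r"
    unfolding B_def r_def by (metis append_take_drop_id drop_drop)
  moreover have "r = take d r @ B k @ drop (n + k * (n + 1)) w"
    unfolding B_def r_def k_eq by (metis append_take_drop_id drop_drop)
  ultimately have "w = take (j * (n + 1)) w @ (B j @ take d r @ B j) @ drop (n + k * (n + 1)) w"
    using jk(3) by (metis append.assoc)
  then have "sublist (B j @ take d r @ B j) w"
    by (metis sublist_appendI)
  moreover have "take d r \<noteq> []"
    using block_end[OF jk(2)] k_eq \<open>d > 0\<close> len[OF jk(2)]
    by (cases "n = 0") (auto simp: r_def)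
  ultimately show thesis
    using that len jk by (metis less_imp_le order_trans)
qed

lemma forces_zimin_Suc:
  assumes A: "finite A" and n: "forces A n (zimin i)"
  shows "forces A (card A ^ n * (n + 1) + n) (zimin (Suc i))"
  unfolding forces_def
proof (intro ballI impI)
  fix w assume w: "w \<in> lists A" "length w = card A ^ n * (n + 1) + n"
  then obtain u c where uc: "length u = n" "c \<noteq> []" "sublist (u @ c @ u) w"
    using repeated_block[OF A] by (metis order_refl)
  then have "u \<in> lists A" "c \<in> lists A"
    using w(1) set_mono_sublist[OF uc(3)] by auto
  with uc n show "encounters A w (zimin (Suc i))"
    unfolding forces_def by (blast intro: encounters_zimin_Suc encounters_sublist)
qed

text \<open>Even for the empty pattern a morphism must give every variable a nonempty value, hence a
  letter of \<open>A\<close> is required.\<close>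

lemma forces_zimin_0: "A \<noteq> {} \<Longrightarrow> forces A 0 (zimin 0)"
  by (auto simp: forces_def intro!: encountersI[of "\<lambda>_. [SOME a. a \<in> A]"] some_in_eq[THEN iffD2])

fun zimin_bound :: "nat \<Rightarrow> nat \<Rightarrow> nat" where
  "zimin_bound m 0 = 0"
| "zimin_bound m (Suc i) = m ^ zimin_bound m i * (zimin_bound m i + 1) + zimin_bound m i"

lemma forces_zimin_bound:
  assumes "finite A" and "A \<noteq> {}"
  shows "forces A (zimin_bound (card A) i) (zimin i)"
proof (induction i)
  case 0
  then show ?case using forces_zimin_0[OF assms(2)] by simp
next
  case (Suc i)
  then show ?case using forces_zimin_Suc[OF assms(1)] by simp
qed

text \<open>A single admissible length bounds the \<open>LEAST\<close> and shows that it is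
  meaningful; \<open>m > 0\<close> makes the alphabet nonempty.\<close>

lemma ramsey_length_zimin_le:
  assumes "m > 0"
  shows "ramsey_length m (zimin i) \<le> zimin_bound m i"
  unfolding ramsey_length_def
proof (rule Least_le, intro allI impI)
  fix A :: "nat set" assume A: "finite A \<and> card A = m"
  then have "A \<noteq> {}" using assms by auto
  with A show "\<forall>w \<in> lists A. length w = zimin_bound m i \<longrightarrow> encounters A w (zimin i)"
    using forces_zimin_bound[of A i] by (simp add: forces_def)
qed

lemma double_le_power:
  fixes m t :: nat
  assumes "m \<ge> 2" and "t \<ge> 1"
  shows "2 * t \<le> m ^ t"
  using assms(2)
proof (induction t rule: dec_induct)
  case base
  then show ?case using assms(1) by simp
next
  case (step t)
  have "2 * Suc t \<le> 2 * (2 * t)" using step.hyps by simp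
  also have "\<dots> \<le> m * m ^ t" using step.IH assms(1) by (intro mult_le_mono)
  finally show ?case by simp
qed

text \<open>The left side is less than \<open>(m ^ n + 1) * (n + 1)\<close>. Both factors are at
  most \<open>m ^ t\<close>, because \<open>n < t\<close> leaves room for one more factor
  \<open>m\<close>, and \<open>2 * t \<le> m ^ t\<close> absorbs the square. With a tower for
  \<open>t\<close>, the bound is the tower two levels higher.\<close>

lemma recursion_step_less:
  fixes m n t :: nat
  assumes m: "m \<ge> 2" and n: "n < t"
  shows "m ^ n * (n + 1) + n < m ^ m ^ t"
proof -
  have t: "2 * t \<le> m ^ t" using double_le_power[of m t] m n by simp
  have "1 \<le> m ^ n" using m by simp
  then have "m ^ n + 1 \<le> 2 * m ^ n" by linarith
  also have "\<dots> \<le> m ^ Suc n" using m by simp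
  also have "\<dots> \<le> m ^ t" using m n by (intro power_increasing) auto
  finally have "m ^ n + 1 \<le> m ^ t" .
  have "m ^ n * (n + 1) + n < (m ^ n + 1) * (n + 1)" by simp
  also have "\<dots> \<le> m ^ t * m ^ t"
    using \<open>m ^ n + 1 \<le> m ^ t\<close> n t by (intro mult_le_mono) auto
  also have "\<dots> = m ^ (2 * t)" by (simp add: mult_2 power_add)
  also have "\<dots> \<le> m ^ m ^ t" using m t by (intro power_increasing) auto
  finally show ?thesis .
qed

lemma zimin_bound_less:
  assumes m: "m \<ge> 2" and "i \<ge> 1"
  shows "zimin_bound m i < m \<up>\<up> (2 * i - 1)"
  using assms(2)
proof (induction i rule: dec_induct)
  \<comment> \<open>Here the claim is \<open>1 < m\<close>, the only place where the strict
    inequality starts.\<close>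
  case base
  then show ?case using m by simp
next
  case (step i)
  then have "2 * Suc i - 1 = Suc (Suc (2 * i - 1))" by simp
  then show ?case using recursion_step_less[OF m step.IH]
    by (simp only: zimin_bound.simps up_up.simps)
qed

theorem theorem6:
  fixes m i :: nat
  assumes "m \<ge> 2" and "i \<ge> 2"
  shows "ramsey_length m (zimin i) < m \<up>\<up> (2 * i - 1)"
  using ramsey_length_zimin_le[of m i] zimin_bound_less[of m i] assms by simp

end
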